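(* Let $(\mathbb{Z},\mathsf{E}_n)$ be a self-similar graph such that $m_i\neq 0$ for all $1\le i\le\kappa$. The following are equivalent: (a) $(\mathbb{Z},\mathsf{E}_n)$ is periodic; (b) the restriction $(\mathbb{Z},\mathsf{E}_{n_i})$ is periodic for each $1\le i\le\kappa$; (c) $n_i\mid m_i$ for every $1\le i\le\kappa$.
   Context: Write $\mathbb{Z}=\langle a\rangle$ multiplicatively. For $n\ge 1$, $\mathsf{E}_n$ is the directed graph with one vertex and $n$ edges; $\mathsf{E}_n^1$ is its edge set, $\mathsf{E}_n^*$ its set of finite paths (the free monoid on $\mathsf{E}_n^1$), $\mathsf{E}_n^\infty$ its set of infinite paths $x=x_1x_2\cdots$, $x_j\in\mathsf{E}_n^1$. A self-similar graph $(\mathbb{Z},\mathsf{E}_n)$ is a left action $(g,\mu)\mapsto g\cdot\mu$ of $\mathbb{Z}$ on $\mathsf{E}_n^*$ by length-preserving bijections together with a map $\mathbb{Z}\times\mathsf{E}_n^*\to\mathbb{Z}$, $(g,\mu)\mapsto g|_\mu$, such that for all $g,h\in\mathbb{Z}$, $\mu,\nu\in\mathsf{E}_n^*$: $g\cdot(\mu\nu)=(g\cdot\mu)(g|_\mu\cdot\nu)$; $g|_{v}=g$ for the vertex (empty path) $v$; $g|_{\mu\nu}=(g|_\mu)|_\nu$; $1|_\mu=1$ for the identity $1$ of $\mathbb{Z}$; $(gh)|_\mu=g|_{h\cdot\mu}\,h|_\mu$. The action extends to $\mathsf{E}_n^\infty$ by $g\cdot(x_1x_2x_3\cdots)=(g\cdot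 x_1)(g|_{x_1}\cdot x_2)(g|_{x_1x_2}\cdot x_3)\cdots$. The action on $\mathsf{E}_n^1$ has $\kappa$ orbits $\mathcal{E}_i=\{e^i_s: 0\le s\le n_i-1\}$, $1\le i\le\kappa$, labelled so that $a\cdot e^i_s=e^i_{s+1 \bmod n_i}$; thus $n=\sum_i n_i$. The integer $m_i$ is defined by $a^{m_i}=\prod_{s=0}^{n_i-1}a|_{e^i_s}$. The restriction $(\mathbb{Z},\mathsf{E}_{n_i})$ is the self-similar graph obtained by restricting the action and the restriction map to the one-vertex graph with edge set $\mathcal{E}_i$. Let $\sigma^p$ ($p\in\mathbb{N}$) be the shift deleting the first $p$ edges of an infinite path. A path $x\in\mathsf{E}_n^\infty$ is $\mathbb{Z}$-aperiodic if $\sigma^p(x)\ne g\cdot\sigma^q(x)$ for all $g\in\mathbb{Z}$, $p,q\in\mathbb{N}$ with $g\neq 1$ or $p\ne q$. $(\mathbb{Z},\mathsf{E}_n)$ is aperiodic if there is a $\mathbb{Z}$-aperiodic path in $\mathsf{E}_n^\infty$, and periodic otherwise. *)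

theory Defs
  imports Complex_Main
begin

text \<open>The infinite cyclic group generated by \<open>a\<close> is the additive group of type \<^typ>\<open>int\<close>,
  with \<open>a = 1\<close> and identity \<open>0\<close>; hence products of group elements become sums and \<open>a\<^sup>m\<close> is
  the integer \<open>m\<close>. The graph with one vertex and \<open>n\<close> edges is its edge set \<open>E\<close>, a nonempty
  finite set with \<open>n\<close> elements; finite paths are the elements of \<^term>\<open>lists E\<close>, the vertex
  being the empty list.\<close>

locale self_similar_graph =
  fixes E :: "'e set"
    and act :: "int \<Rightarrow> 'e list \<Rightarrow> 'e list"
    and res :: "int \<Rightarrow> 'e list \<Rightarrow> int"
  assumes finite_edges: "finite E"
    and edges_nonempty: "E \<noteq> {}"
    and act_bij: "bij_betw (act g) (lists E) (lists E)"
    and act_length: "\<mu> \<in> lists E \<Longrightarrow> length (act g \<mu>) = length \<mu>"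
    and act_zero: "\<mu> \<in> lists E \<Longrightarrow> act 0 \<mu> = \<mu>"
    and act_add: "\<mu> \<in> lists E \<Longrightarrow> act (g + h) \<mu> = act g (act h \<mu>)"
    and act_append: "\<mu> \<in> lists E \<Longrightarrow> \<nu> \<in> lists E \<Longrightarrow>
      act g (\<mu> @ \<nu>) = act g \<mu> @ act (res g \<mu>) \<nu>"
    and res_Nil: "res g [] = g"
    and res_append: "\<mu> \<in> lists E \<Longrightarrow> \<nu> \<in> lists E \<Longrightarrow> res g (\<mu> @ \<nu>) = res (res g \<mu>) \<nu>"
    and res_zero: "\<mu> \<in> lists E \<Longrightarrow> res 0 \<mu> = 0"
    and res_add: "\<mu> \<in> lists E \<Longrightarrow> res (g + h) \<mu> = res g (act h \<mu>) + res h \<mu>"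

definition infinite_paths :: "'e set \<Rightarrow> (nat \<Rightarrow> 'e) set" where
  "infinite_paths E = {x. \<forall>j. x j \<in> E}"

definition shift :: "nat \<Rightarrow> (nat \<Rightarrow> 'e) \<Rightarrow> nat \<Rightarrow> 'e" where
  "shift p x = (\<lambda>j. x (p + j))"

definition edge_act :: "(int \<Rightarrow> 'e list \<Rightarrow> 'e list) \<Rightarrow> int \<Rightarrow> 'e \<Rightarrow> 'e" where
  "edge_act act g e = hd (act g [e])"

text \<open>Paths are indexed from \<open>0\<close>, so the edge with index \<open>j\<close> is moved by the restriction of
  \<open>g\<close> to the \<open>j\<close> edges preceding it.\<close>

definition inf_act ::
  "(int \<Rightarrow> 'e list \<Rightarrow> 'e list) \<Rightarrow> (int \<Rightarrow> 'e list \<Rightarrow> int) \<Rightarrow> int \<Rightarrow> (nat \<Rightarrow> 'e) \<Rightarrow> nat \<Rightarrow> 'e" where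
  "inf_act act res g x = (\<lambda>j. edge_act act (res g (map x [0..<j])) (x j))"

definition aperiodic_path ::
  "(int \<Rightarrow> 'e list \<Rightarrow> 'e list) \<Rightarrow> (int \<Rightarrow> 'e list \<Rightarrow> int) \<Rightarrow> (nat \<Rightarrow> 'e) \<Rightarrow> bool" where
  "aperiodic_path act res x \<longleftrightarrow>
    (\<forall>g p q. g \<noteq> 0 \<or> p \<noteq> q \<longrightarrow> shift p x \<noteq> inf_act act res g (shift q x))"

definition aperiodic_graph ::
  "'e set \<Rightarrow> (int \<Rightarrow> 'e list \<Rightarrow> 'e list) \<Rightarrow> (int \<Rightarrow> 'e list \<Rightarrow> int) \<Rightarrow> bool" where
  "aperiodic_graph E act res \<longleftrightarrow> (\<exists>x \<in> infinite_paths E. aperiodic_path act res x)"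

definition periodic_graph ::
  "'e set \<Rightarrow> (int \<Rightarrow> 'e list \<Rightarrow> 'e list) \<Rightarrow> (int \<Rightarrow> 'e list \<Rightarrow> int) \<Rightarrow> bool" where
  "periodic_graph E act res \<longleftrightarrow> \<not> aperiodic_graph E act res"

definition edge_orbit :: "(int \<Rightarrow> 'e list \<Rightarrow> 'e list) \<Rightarrow> 'e \<Rightarrow> 'e set" where
  "edge_orbit act e = range (\<lambda>g. edge_act act g e)"

definition labelled_orbit :: "(nat \<Rightarrow> nat) \<Rightarrow> (nat \<Rightarrow> nat \<Rightarrow> 'e) \<Rightarrow> nat \<Rightarrow> 'e set" where
  "labelled_orbit n e i = {e i s | s. s < n i}"

text \<open>The sets \<^term>\<open>labelled_orbit n e i\<close> for \<open>1 \<le> i \<le> \<kappa>\<close> enumerate the orbits of \<open>E\<close> without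
  repetition, and the labels \<open>0, \<dots>, n i - 1\<close> enumerate the \<open>i\<close>-th orbit without repetition, in
  the cyclic order given by the generator.\<close>

definition orbit_labelling ::
  "'e set \<Rightarrow> (int \<Rightarrow> 'e list \<Rightarrow> 'e list) \<Rightarrow> nat \<Rightarrow> (nat \<Rightarrow> nat) \<Rightarrow> (nat \<Rightarrow> nat \<Rightarrow> 'e) \<Rightarrow> bool" where
  "orbit_labelling E act \<kappa> n e \<longleftrightarrow>
    bij_betw (labelled_orbit n e) {1..\<kappa>} (edge_orbit act ` E) \<and>
    (\<forall>i \<in> {1..\<kappa>}. inj_on (e i) {..<n i} \<and>
      (\<forall>s < n i. edge_act act 1 (e i s) = e i ((s + 1) mod n i)))"

definition orbit_exponent ::
  "(int \<Rightarrow> 'e list \<Rightarrow> int) \<Rightarrow> (nat \<Rightarrow> nat) \<Rightarrow> (nat \<Rightarrow> nat \<Rightarrow> 'e) \<Rightarrow> nat \<Rightarrow> int" where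
  "orbit_exponent res n e i = (\<Sum>s < n i. res 1 [e i s])"

context self_similar_graph
begin

lemma act_in: "\<mu> \<in> lists E \<Longrightarrow> act g \<mu> \<in> lists E"
  using act_bij bij_betwE by blast

lemma act_single: "x \<in> E \<Longrightarrow> act g [x] = [edge_act act g x]"
proof -
  assume "x \<in> E"
  then have "length (act g [x]) = 1" using act_length[of "[x]" g] by simp
  then show ?thesis unfolding edge_act_def by (cases "act g [x]") auto
qed

lemma edge_act_in: "x \<in> E \<Longrightarrow> edge_act act g x \<in> E"
  using act_in[of "[x]" g] act_single[of x g] by simp

lemma edge_act_add: "x \<in> E \<Longrightarrow> edge_act act (g + h) x = edge_act act g (edge_act act h x)"
  using act_add[of "[x]" g h] act_single edge_act_in by simp

lemma edge_orbit_subset: "x \<in> E \<Longrightarrow> edge_orbit act x \<subseteq> E"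
  unfolding edge_orbit_def using edge_act_in by auto

lemma edge_orbit_closed:
  "x \<in> E \<Longrightarrow> y \<in> edge_orbit act x \<Longrightarrow> edge_act act g y \<in> edge_orbit act x"
  unfolding edge_orbit_def using edge_act_add by (auto simp flip: edge_act_add)

lemma act_lists_orbit:
  assumes "x \<in> E" "\<mu> \<in> lists (edge_orbit act x)"
  shows "act g \<mu> \<in> lists (edge_orbit act x)"
  using assms(2)
proof (induction \<mu> arbitrary: g)
  case Nil
  have "length (act g []) = 0" using act_length[of "[]" g] by simp
  then show ?case by simp
next
  case (Cons y \<mu>)
  have y: "y \<in> edge_orbit act x" "y \<in> E" and mu: "\<mu> \<in> lists E"
    using Cons.hyps edge_orbit_subset[OF assms(1)] by auto
  have "act g (y # \<mu>) = act g [y] @ act (res g [y]) \<mu>"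
    using act_append[of "[y]" \<mu> g] y mu by simp
  then show ?case
    using act_single y edge_orbit_closed[OF assms(1) y(1)] Cons.IH by simp
qed

text \<open>Restricting to an orbit only shrinks the edge set: the maps \<open>act\<close> and \<open>res\<close> are kept and
  their values outside \<^term>\<open>lists (edge_orbit act x)\<close> are irrelevant.\<close>

lemma restriction_self_similar:
  assumes x: "x \<in> E"
  shows "self_similar_graph (edge_orbit act x) act res"
proof -
  let ?F = "edge_orbit act x"
  have sub: "\<mu> \<in> lists E" if "\<mu> \<in> lists ?F" for \<mu>
    using that edge_orbit_subset[OF x] by auto
  have bij: "bij_betw (act g) (lists ?F) (lists ?F)" for g
  proof (rule bij_betw_byWitness[where f' = "act (- g)"])
    show "\<forall>\<mu>\<in>lists ?F. act (- g) (act g \<mu>) = \<mu>"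
      by (metis sub act_add act_zero add.left_inverse)
    show "\<forall>\<mu>\<in>lists ?F. act g (act (- g) \<mu>) = \<mu>"
      by (metis sub act_add act_zero add.right_inverse)
  qed (use act_lists_orbit[OF x] in auto)
  show ?thesis
  proof
    show "finite ?F" using finite_subset[OF edge_orbit_subset[OF x] finite_edges] .
    show "?F \<noteq> {}" unfolding edge_orbit_def by simp
  qed (use bij sub act_length act_zero act_add act_append res_Nil res_append res_zero res_add
      in auto)
qed

end

end

theory Submission
  imports Defs "HOL-Library.Countable"
begin

text \<open>An element \<open>g\<close> fixes an edge of the \<open>i\<close>-th orbit iff \<open>n\<^sub>i\<close> divides \<open>g\<close>, and its restriction
  there is then \<open>g m\<^sub>i / n\<^sub>i\<close>. If all \<open>m\<^sub>i / n\<^sub>i\<close> are integers, the product of the \<open>n\<^sub>i\<close> acts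
  trivially on all paths. If \<open>m\<^sub>i / n\<^sub>i\<close> is not an integer, no \<open>g \<noteq> 0\<close> fixes an infinite path in the
  \<open>i\<close>-th orbit, since \<open>g (m\<^sub>i / n\<^sub>i)\<^sup>j\<close> would have to be an integer for all \<open>j\<close>; and for \<open>p \<noteq> q\<close> a
  path \<open>x\<close> with \<open>\<sigma>\<^sup>p x = g \<cdot> \<sigma>\<^sup>q x\<close> is determined by \<open>g\<close>, \<open>p\<close>, \<open>q\<close> and a finite prefix, so that only
  countably many of the uncountably many paths fail to be aperiodic. Since aperiodicity of a path
  does not depend on the ambient edge set, an aperiodic path of a restriction is one of the whole
  graph.\<close>

text \<open>After cancelling the gcd, the reduced denominator n' of m/n is coprime to the numerator,
  so every power of n' divides the fixed nonzero g. This forces n' = 1.\<close>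

lemma dvd_if_power_dvd_mult_power:
  fixes n m g :: int
  assumes "g \<noteq> 0" "n > 0" and dvd: "\<And>j::nat. n ^ j dvd g * m ^ j"
  shows "n dvd m"
proof -
  define d where "d = gcd n m"
  have "d > 0" using \<open>n > 0\<close> by (simp add: d_def)
  obtain n' m' where nm: "n = n' * d" "m = m' * d" and cop: "coprime n' m'"
    using gcd_coprime_exists[of n m] \<open>n > 0\<close> unfolding d_def by force
  have "n' > 0" using nm \<open>d > 0\<close> \<open>n > 0\<close> by (simp add: zero_less_mult_iff)
  have pow: "n' ^ j dvd g" for j
  proof -
    have "n' ^ j * d ^ j dvd (g * m' ^ j) * d ^ j"
      using dvd[of j] by (simp add: nm power_mult_distrib mult.assoc)
    then have "n' ^ j dvd g * m' ^ j" using \<open>d > 0\<close> by simp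
    then show ?thesis using cop by (simp add: coprime_dvd_mult_left_iff)
  qed
  have "n' = 1"
  proof (rule ccontr)
    assume "n' \<noteq> 1"
    then have "n' \<ge> 2" using \<open>n' > 0\<close> by simp
    \<comment> \<open>With this exponent, n' ^ j is at least 2 ^ j and so exceeds |g|, too large for
      a divisor of g.\<close>
    define j where "j = nat \<bar>g\<bar>"
    have "int j < 2 ^ j" using less_exp[of j] by (metis of_nat_less_numeral_power_cancel_iff)
    also have "(2::int) ^ j \<le> n' ^ j" using \<open>n' \<ge> 2\<close> by (simp add: power_mono)
    also have "n' ^ j \<le> \<bar>g\<bar>" using zdvd_imp_le[of "n' ^ j" "\<bar>g\<bar>"] pow[of j] \<open>g \<noteq> 0\<close> by simp
    finally show False by (simp add: j_def)
  qed
  then show ?thesis using nm by simp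
qed

section \<open>Paths over a general self-similar graph\<close>

context self_similar_graph
begin

lemma edge_act_zero: "x \<in> E \<Longrightarrow> edge_act act 0 x = x"
  using act_zero[of "[x]"] by (simp add: edge_act_def)

lemma edge_act_inj:
  assumes "x \<in> E" "y \<in> E" "edge_act act g x = edge_act act g y"
  shows "x = y"
  using assms edge_act_add[of _ "- g" g] edge_act_zero by (metis add.left_inverse)

lemma res_add_edge:
  "x \<in> E \<Longrightarrow> res (g + h) [x] = res g [edge_act act h x] + res h [x]"
  using res_add[of "[x]" g h] act_single by simp

lemma res_path_Suc:
  assumes "x \<in> infinite_paths E"
  shows "res g (map x [0..<Suc j]) = res (res g (map x [0..<j])) [x j]"
proof -
  have "map x [0..<j] \<in> lists E" "[x j] \<in> lists E"
    using assms by (auto simp: infinite_paths_def)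
  then show ?thesis using res_append by simp
qed

text \<open>\<open>P\<close> is a set of elements that fix every edge and whose restrictions to
  edges stay in \<open>P\<close>. By induction along the path, every restriction met there lies in
  \<open>P\<close>.\<close>

lemma inf_act_fixed:
  assumes x: "x \<in> infinite_paths E" and "g \<in> P"
    and P: "\<And>h y. h \<in> P \<Longrightarrow> y \<in> E \<Longrightarrow> edge_act act h y = y \<and> res h [y] \<in> P"
  shows "inf_act act res g x = x"
proof -
  have xE: "x j \<in> E" for j using x by (simp add: infinite_paths_def)
  have "res g (map x [0..<j]) \<in> P" for j
  proof (induction j)
    case 0 then show ?case using \<open>g \<in> P\<close> by (simp add: res_Nil)
  next
    case (Suc j) then show ?case unfolding res_path_Suc[OF x] using P xE by blast
  qed
  then show ?thesis unfolding inf_act_def using P xE by blast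
qed

text \<open>The relation links the edges with indices p + i and q + i by a bijection that depends
  only on \<open>g\<close> and on edges before max p q + i. So the later of the two is determined by
  earlier edges: directly if q < p, by injectivity of the action if p < q.\<close>

lemma shift_eq_inf_act_determined:
  assumes x: "x \<in> infinite_paths E" and y: "y \<in> infinite_paths E" and "p \<noteq> q"
    and eqx: "shift p x = inf_act act res g (shift q x)"
    and eqy: "shift p y = inf_act act res g (shift q y)"
    and prefix: "\<And>j. j < max p q \<Longrightarrow> x j = y j"
  shows "x = y"
proof
  fix j show "x j = y j"
  proof (induction j rule: less_induct)
    case (less j)
    show ?case
    proof (cases "j < max p q")
      case True then show ?thesis by (rule prefix)
    next
      case False
      define i where "i = j - max p q"
      have j: "j = max p q + i" using False by (simp add: i_def)
      define h where "h = res g (map (shift q x) [0..<i])"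
      have "map (shift q x) [0..<i] = map (shift q y) [0..<i]"
        using less.IH by (auto simp: shift_def j)
      then have "h = res g (map (shift q y) [0..<i])" by (simp only: h_def)
      then have hx: "x (p + i) = edge_act act h (x (q + i))"
        and hy: "y (p + i) = edge_act act h (y (q + i))"
        using fun_cong[OF eqx, of i, unfolded inf_act_def, folded h_def]
          fun_cong[OF eqy, of i, unfolded inf_act_def]
        by (simp_all add: shift_def)
      show ?thesis
      proof (cases "q < p")
        case True
        then have "x (q + i) = y (q + i)" using less.IH by (simp add: j)
        then show ?thesis using hx hy True by (simp add: j max_def)
      next
        case False
        then have "p < q" using \<open>p \<noteq> q\<close> by simp
        then have "x (p + i) = y (p + i)" using less.IH by (simp add: j)
        then have "x (q + i) = y (q + i)"
          using hx hy x y edge_act_inj[of "x (q + i)" "y (q + i)" h]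
          by (simp add: infinite_paths_def)
        then show ?thesis using \<open>p < q\<close> by (simp add: j max_def)
      qed
    qed
  qed
qed

lemma exists_path_not_shift_related:
  assumes "a \<in> E" "b \<in> E" "a \<noteq> b"
  obtains x where "\<And>j. x j \<in> {a, b}"
    "\<And>g p q. p \<noteq> q \<Longrightarrow> shift p x \<noteq> inf_act act res g (shift q x)"
proof -
  define path where "path S = (\<lambda>j::nat. if j \<in> S then a else b)" for S
  have path_E: "path S \<in> infinite_paths E" for S
    using assms by (simp add: path_def infinite_paths_def)
  have "\<exists>S. \<forall>g p q. p \<noteq> q \<longrightarrow> shift p (path S) \<noteq> inf_act act res g (shift q (path S))"
  proof (rule ccontr)
    assume "\<not> ?thesis"
    then have "\<forall>S. \<exists>g p q. p \<noteq> q \<and> shift p (path S) = inf_act act res g (shift q (path S))"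
      by blast
    then obtain g p q where neq: "\<And>S. p S \<noteq> q S"
      and eq: "\<And>S. shift (p S) (path S) = inf_act act res (g S) (shift (q S) (path S))"
      by metis
    define code where
      \<comment> \<open>Paths over two edges correspond to subsets of \<nat>. This code takes values
        in a countable type, so its injectivity would contradict Cantor's theorem.\<close>
      "code S = (g S, p S, q S, map (\<lambda>j. j \<in> S) [0..<max (p S) (q S)])" for S
    have "inj code"
    proof (rule injI)
      fix S T assume "code S = code T"
      then have same: "g S = g T" "p S = p T" "q S = q T"
        and "map (\<lambda>j. j \<in> S) [0..<max (p S) (q S)] = map (\<lambda>j. j \<in> T) [0..<max (p S) (q S)]"
        by (auto simp: code_def)
      then have "path S j = path T j" if "j < max (p S) (q S)" for j
        using that by (auto simp: path_def)
      then have "path S = path T"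
        using shift_eq_inf_act_determined[OF path_E path_E neq eq[of S], of T] eq[of T] same by auto
      then have "j \<in> S \<longleftrightarrow> j \<in> T" for j
        using assms(3) by (metis path_def)
      then show "S = T" by blast
    qed
    then have "inj (to_nat \<circ> code)" by (intro inj_compose) auto
    then have "surj (inv (to_nat \<circ> code))" by (rule inj_imp_surj_inv)
    then show False using Cantors_theorem[of UNIV] by (metis Pow_UNIV)
  qed
  then obtain S
    where S: "p \<noteq> q \<Longrightarrow> shift p (path S) \<noteq> inf_act act res g (shift q (path S))" for g p q
    by blast
  show thesis
  proof (rule that)
    show "path S j \<in> {a, b}" for j by (simp add: path_def)
  qed (rule S)
qed

end

section \<open>A single cyclic orbit of edges\<close>

locale edge_cycle = self_similar_graph +
  fixes n :: nat and f :: "nat \<Rightarrow> 'a"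
  assumes n_pos: "n > 0"
    and f_in: "s < n \<Longrightarrow> f s \<in> E"
    and f_inj: "inj_on f {..<n}"
    and f_step: "s < n \<Longrightarrow> edge_act act 1 (f s) = f ((s + 1) mod n)"
begin

definition exponent :: int where
  "exponent = (\<Sum>s<n. res 1 [f s])"

lemma edge_act_nat: "s < n \<Longrightarrow> edge_act act (int k) (f s) = f ((s + k) mod n)"
proof (induction k)
  case 0 then show ?case using edge_act_zero f_in by simp
next
  case (Suc k)
  have "edge_act act (int (Suc k)) (f s) = edge_act act 1 (edge_act act (int k) (f s))"
    using edge_act_add[of "f s" 1 "int k"] f_in Suc.prems by simp
  also have "\<dots> = f ((s + Suc k) mod n)"
    using Suc f_step[of "(s + k) mod n"] n_pos by (simp add: mod_Suc_eq)
  finally show ?case .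
qed

lemma res_nat: "s < n \<Longrightarrow> res (int k) [f s] = (\<Sum>j<k. res 1 [f ((s + j) mod n)])"
proof (induction k)
  case 0 then show ?case using res_zero[of "[f s]"] f_in by simp
next
  case (Suc k)
  then show ?case
    using res_add_edge[of "f s" 1 "int k"] f_in edge_act_nat by simp
qed

text \<open>Starting the full turn at \<open>f s\<close> only rotates the labels, so the sum of the
  restrictions of the generator is the same for every start.\<close>

lemma res_period:
  assumes "s < n"
  shows "res (int n) [f s] = exponent"
proof -
  have inj: "inj_on (\<lambda>j. (s + j) mod n) {..<n}"
  proof (rule inj_onI)
    fix i j assume "i \<in> {..<n}" "j \<in> {..<n}" "(s + i) mod n = (s + j) mod n"
    moreover have "(s + k) mod n = (if s + k < n then s + k else s + k - n)" if "k < n" for k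
      using that assms by (simp add: le_mod_geq)
    ultimately show "i = j" using assms by (simp split: if_splits)
  qed
  have "(\<lambda>j. (s + j) mod n) ` {..<n} = {..<n}"
    using n_pos by (intro endo_inj_surj[OF _ _ inj]) auto
  then have "(\<Sum>j<n. res 1 [f ((s + j) mod n)]) = exponent"
    unfolding exponent_def using sum.reindex[OF inj, of "\<lambda>s. res 1 [f s]"] by simp
  then show ?thesis using res_nat[OF assms] by simp
qed

lemma multiple_nat:
  assumes "s < n"
  shows "edge_act act (int n * int k) (f s) = f s \<and> res (int n * int k) [f s] = int k * exponent"
proof
  have fix_k: "edge_act act (int n * int k) (f s) = f s" for k
    using edge_act_nat[OF assms, of "n * k"] assms by simp
  then show "edge_act act (int n * int k) (f s) = f s" .
  show "res (int n * int k) [f s] = int k * exponent"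
  proof (induction k)
    case 0 then show ?case using res_zero[of "[f s]"] f_in assms by simp
  next
    case (Suc k)
    then show ?case
      using res_add_edge[of "f s" "int n" "int n * int k"] f_in assms fix_k res_period
      by (simp add: algebra_simps)
  qed
qed

lemma multiple_int:
  assumes "s < n"
  shows "edge_act act (int n * k) (f s) = f s \<and> res (int n * k) [f s] = k * exponent"
proof (cases "k \<ge> 0")
  case True
  then show ?thesis using multiple_nat[OF assms, of "nat k"] by simp
next
  case False
  \<comment> \<open>For negative multiples, the restrictions of an element and its inverse at a
    fixed edge add up to zero.\<close>
  let ?h = "int n * (- k)"
  have h: "edge_act act ?h (f s) = f s" "res ?h [f s] = - k * exponent"
    using multiple_nat[OF assms, of "nat (- k)"] False by simp_all
  have "edge_act act (int n * k) (f s) = f s"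
    using edge_act_add[of "f s" "int n * k" ?h] edge_act_zero f_in assms h by simp
  moreover have "res (int n * k) [f s] + res ?h [f s] = 0"
    using res_add_edge[of "f s" "int n * k" ?h] res_zero[of "[f s]"] f_in assms h by simp
  ultimately show ?thesis using h by simp
qed

lemma dvd_if_edge_act_fixed:
  assumes s: "s < n" and fixed: "edge_act act g (f s) = f s"
  shows "int n dvd g"
proof -
  \<comment> \<open>The multiple of \<open>n\<close> contained in \<open>g\<close> fixes the edge,
    so \<open>g\<close> moves it as its remainder \<open>r\<close> does, and injectivity of the
    labels gives r = 0.\<close>
  define r where "r = nat (g mod int n)"
  have r: "r < n" "int r = g mod int n" using n_pos by (auto simp: r_def nat_less_iff)
  have "g = int r + int n * (g div int n)" using r by simp
  then have "edge_act act g (f s) = f ((s + r) mod n)"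
    using edge_act_add[OF f_in[OF s]] multiple_int[OF s] edge_act_nat[OF s] by metis
  then have "(s + r) mod n = s"
    using fixed inj_onD[OF f_inj, of "(s + r) mod n" s] s n_pos by simp
  then have "r = 0" using s r(1) by (auto simp: mod_if split: if_splits)
  then show ?thesis using r by (simp add: dvd_eq_mod_eq_0)
qed

lemma edge_fixed_res:
  assumes "s < n" "edge_act act g (f s) = f s"
  shows "int n * res g [f s] = g * exponent"
  using dvd_if_edge_act_fixed[OF assms] multiple_int[OF assms(1)] by (auto elim: dvdE)

text \<open>Along a fixed path each restriction is \<open>exponent / n\<close> times the preceding
  one. Clearing denominators, \<open>n ^ j\<close> divides \<open>g * exponent ^ j\<close> for every
  \<open>j\<close>, hence \<open>n\<close> would divide \<open>exponent\<close>.\<close>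

lemma no_fixed_path:
  assumes ndvd: "\<not> int n dvd exponent" and x: "\<And>j. x j \<in> f ` {..<n}" and "g \<noteq> 0"
  shows "inf_act act res g x \<noteq> x"
proof
  assume fixed: "inf_act act res g x = x"
  have "x j \<in> E" for j using x[of j] f_in by auto
  then have xE: "x \<in> infinite_paths E" by (simp add: infinite_paths_def)
  define r where "r j = res g (map x [0..<j])" for j
  have step: "int n * r (Suc j) = r j * exponent" for j
  proof -
    obtain s where s: "s < n" "x j = f s" using x[of j] by auto
    have "edge_act act (r j) (x j) = x j"
      using fun_cong[OF fixed, of j] by (simp add: inf_act_def r_def)
    moreover have "r (Suc j) = res (r j) [x j]" unfolding r_def by (rule res_path_Suc[OF xE])
    ultimately show ?thesis using edge_fixed_res s by simp
  qed
  have "int n ^ j * r j = g * exponent ^ j" for j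
  proof (induction j)
    case 0 then show ?case by (simp add: r_def res_Nil)
  next
    case (Suc j)
    have "int n ^ Suc j * r (Suc j) = int n ^ j * (int n * r (Suc j))" by simp
    also have "\<dots> = (int n ^ j * r j) * exponent" by (simp add: step)
    finally show ?case using Suc by simp
  qed
  then have pow: "int n ^ j dvd g * exponent ^ j" for j by (metis dvd_triv_left)
  have "int n dvd exponent"
    using \<open>g \<noteq> 0\<close> n_pos by (intro dvd_if_power_dvd_mult_power[OF _ _ pow]) simp_all
  then show False using ndvd by contradiction
qed

lemma aperiodic_if_not_dvd:
  assumes ndvd: "\<not> int n dvd exponent"
  shows "aperiodic_graph (f ` {..<n}) act res"
proof -
  \<comment> \<open>Since 1 divides everything, the orbit has at least two edges, as the counting
    argument requires.\<close>
  have n: "1 < n" using n_pos ndvd by (cases "n = 1") auto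
  then have "f 0 \<noteq> f 1" using inj_onD[OF f_inj, of 0 1] by auto
  then obtain x where x: "\<And>j. x j \<in> {f 0, f 1}"
    and shifts: "\<And>g p q. p \<noteq> q \<Longrightarrow> shift p x \<noteq> inf_act act res g (shift q x)"
    using exists_path_not_shift_related[of "f 0" "f 1"] f_in n by (metis n_pos)
  have x_in: "x j \<in> f ` {..<n}" for j using x[of j] n by force
  have "shift p x \<noteq> inf_act act res g (shift q x)" if "g \<noteq> 0 \<or> p \<noteq> q" for g p q
  proof (cases "p = q")
    \<comment> \<open>For p = q the relation says that \<open>g\<close> fixes
      \<open>shift p x\<close>, which is again a path in the orbit.\<close>
    case True
    then show ?thesis
      using that no_fixed_path[OF ndvd, of "shift p x" g] x_in by (auto simp: shift_def)
  qed (rule shifts)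
  then show ?thesis
    unfolding aperiodic_graph_def aperiodic_path_def infinite_paths_def using x_in by blast
qed

end

section \<open>From the orbits to the whole graph\<close>

lemma aperiodic_graph_mono:
  "F \<subseteq> E \<Longrightarrow> aperiodic_graph F act res \<Longrightarrow> aperiodic_graph E act res"
  unfolding aperiodic_graph_def infinite_paths_def by blast

lemma orbit_labelling_cycle:
  assumes "self_similar_graph E act res" and lab: "orbit_labelling E act \<kappa> n e"
    and i: "i \<in> {1..\<kappa>}"
  shows "edge_cycle E act res (n i) (e i)"
proof -
  interpret self_similar_graph E act res by fact
  have "labelled_orbit n e i \<in> edge_orbit act ` E"
    using lab i unfolding orbit_labelling_def by (auto dest: bij_betwE)
  then obtain x where x: "x \<in> E" "labelled_orbit n e i = edge_orbit act x" by blast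
  \<comment> \<open>Positivity of \<open>n i\<close> is not part of \<open>orbit_labelling\<close>;
    it follows because an orbit is nonempty.\<close>
  then have "labelled_orbit n e i \<noteq> {}" by (simp add: edge_orbit_def)
  then have "n i > 0" by (auto simp: labelled_orbit_def)
  moreover have "e i s \<in> E" if "s < n i" for s
    using that edge_orbit_subset[OF x(1)] x(2) by (auto simp: labelled_orbit_def)
  ultimately show ?thesis
    using lab i by unfold_locales (auto simp: orbit_labelling_def)
qed

lemma orbit_labelling_cover:
  assumes "self_similar_graph E act res" and lab: "orbit_labelling E act \<kappa> n e" and "x \<in> E"
  obtains i s where "i \<in> {1..\<kappa>}" "s < n i" "x = e i s"
proof -
  interpret self_similar_graph E act res by fact
  have "x \<in> edge_orbit act x"
    using edge_act_zero[OF \<open>x \<in> E\<close>] unfolding edge_orbit_def by (metis rangeI)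
  moreover obtain i where "i \<in> {1..\<kappa>}" "labelled_orbit n e i = edge_orbit act x"
    using lab \<open>x \<in> E\<close> unfolding orbit_labelling_def bij_betw_def by (metis imageE imageI)
  ultimately show thesis using that by (auto simp: labelled_orbit_def)
qed

lemma labelled_orbit_eq_image: "labelled_orbit n e i = e i ` {..<n i}"
  by (auto simp: labelled_orbit_def)

lemma periodic_if_dvd:
  assumes "self_similar_graph E act res" and lab: "orbit_labelling E act \<kappa> n e"
    and dvd: "\<And>i. i \<in> {1..\<kappa>} \<Longrightarrow> int (n i) dvd orbit_exponent res n e i"
  shows "periodic_graph E act res"
proof -
  interpret self_similar_graph E act res by fact
  define N where "N = (\<Prod>i\<in>{1..\<kappa>}. int (n i))"
  have "N \<noteq> 0"
    using edge_cycle.n_pos[OF orbit_labelling_cycle[OF assms(1) lab]] by (force simp: N_def)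
  \<comment> \<open>The multiples of \<open>N\<close> serve as the set \<open>P\<close> of
    \<open>inf_act_fixed\<close>: if \<open>exponent\<close> is d times \<open>n i\<close>, then
    \<open>h\<close> restricts to \<open>h * d\<close>, again a multiple of
    \<open>N\<close>.\<close>
  have trivial: "edge_act act h y = y \<and> res h [y] \<in> {h. N dvd h}"
    if h: "h \<in> {h. N dvd h}" and y: "y \<in> E" for h y
  proof -
    obtain i s where i: "i \<in> {1..\<kappa>}" and s: "s < n i" and ys: "y = e i s"
      using orbit_labelling_cover[OF assms(1) lab y] .
    interpret edge_cycle E act res "n i" "e i"
      by (rule orbit_labelling_cycle[OF assms(1) lab i])
    have "int (n i) dvd N" unfolding N_def using i by (intro dvd_prodI) auto
    then have "int (n i) dvd h" using h by (auto intro: dvd_trans)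
    then obtain k where k: "h = int (n i) * k" by (elim dvdE)
    obtain d where d: "exponent = int (n i) * d"
      using dvd[OF i] unfolding orbit_exponent_def exponent_def by (elim dvdE)
    have "res h [y] = h * d" using multiple_int[OF s, of k] by (simp add: k d ys)
    moreover have "edge_act act h y = y" using multiple_int[OF s, of k] by (simp add: k ys)
    ultimately show ?thesis using h by simp
  qed
  have "inf_act act res N x = x" if "x \<in> infinite_paths E" for x
    by (rule inf_act_fixed[OF that _ trivial]) auto
  moreover have "shift 0 x = x" for x :: "nat \<Rightarrow> 'a" by (simp add: shift_def)
  \<comment> \<open>Aperiodicity fails at p = q = 0 with the nonzero element
    \<open>N\<close>.\<close>
  ultimately have "\<not> aperiodic_path act res x" if "x \<in> infinite_paths E" for x
    using that \<open>N \<noteq> 0\<close> unfolding aperiodic_path_def by metis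
  then show ?thesis unfolding periodic_graph_def aperiodic_graph_def by blast
qed

theorem proposition3p18:
  fixes E :: "'e set"
    and act :: "int \<Rightarrow> 'e list \<Rightarrow> 'e list"
    and res :: "int \<Rightarrow> 'e list \<Rightarrow> int"
    and \<kappa> :: nat
    and n :: "nat \<Rightarrow> nat"
    and e :: "nat \<Rightarrow> nat \<Rightarrow> 'e"
    and m :: "nat \<Rightarrow> int"
  assumes "self_similar_graph E act res"
    and "orbit_labelling E act \<kappa> n e"
    and "\<And>i. i \<in> {1..\<kappa>} \<Longrightarrow> m i = orbit_exponent res n e i"
    and "\<And>i. i \<in> {1..\<kappa>} \<Longrightarrow> m i \<noteq> 0"
  shows "(periodic_graph E act res \<longleftrightarrow>
           (\<forall>i \<in> {1..\<kappa>}. periodic_graph (labelled_orbit n e i) act res)) \<and>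
         ((\<forall>i \<in> {1..\<kappa>}. periodic_graph (labelled_orbit n e i) act res) \<longleftrightarrow>
           (\<forall>i \<in> {1..\<kappa>}. int (n i) dvd m i))"
proof -
  \<comment> \<open>The equivalences are closed as a cycle: (a) to (b) to (c) to (a).\<close>
  have b_if_a: "periodic_graph (labelled_orbit n e i) act res"
    if "periodic_graph E act res" "i \<in> {1..\<kappa>}" for i
  proof -
    have "labelled_orbit n e i \<subseteq> E"
      using edge_cycle.f_in[OF orbit_labelling_cycle[OF assms(1,2) that(2)]]
      by (auto simp: labelled_orbit_def)
    then show ?thesis using that(1) aperiodic_graph_mono unfolding periodic_graph_def by blast
  qed
  have c_if_b: "int (n i) dvd m i"
    if "periodic_graph (labelled_orbit n e i) act res" and i: "i \<in> {1..\<kappa>}" for i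
  proof -
    interpret edge_cycle E act res "n i" "e i"
      by (rule orbit_labelling_cycle[OF assms(1,2) i])
    show ?thesis
      using that(1) aperiodic_if_not_dvd assms(3)[OF i]
      unfolding periodic_graph_def labelled_orbit_eq_image orbit_exponent_def exponent_def by auto
  qed
  have a_if_c: "periodic_graph E act res" if "\<forall>i \<in> {1..\<kappa>}. int (n i) dvd m i"
    using periodic_if_dvd[OF assms(1,2)] that assms(3) by simp
  show ?thesis using b_if_a c_if_b a_if_c by blast
qed

end
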